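(* Let $N\ge 1$. The optimal value of the stochastic optimal control problem $$\min_{\mu_0,\dots,\mu_{N-1}}\ \frac1N\sum_{k=0}^{N-1}\mathbf{E}\{z_k^Tz_k\}$$ subject to, for all $k$, $$x_{k+1}=\Big(A+\sum_{i=1}^M\sigma_k(i)A_i\Big)x_k+Bu_k+w_k,\qquad x_0=0,\qquad z_k=Cx_k+Du_k,\qquad u_k=\mu_k(x_0,\dots,x_k),$$ is equal to the optimal value of the semidefinite program $$\min_{V_0,\dots,V_{N-1}\succeq 0}\ \frac1N\sum_{k=0}^{N-1}\mathbf{Tr}\left(\begin{bmatrix}C&D\end{bmatrix}V_k\begin{bmatrix}C&D\end{bmatrix}^T\right)$$ subject to $$FV_{k+1}F^T=\begin{bmatrix}A&B\end{bmatrix}V_k\begin{bmatrix}A&B\end{bmatrix}^T+\sum_{i=1}^MA_iFV_kF^TA_i^T+I,\qquad k=0,\dots,N-2,$$ where the $V_k$ are real symmetric $(n+m)\times(n+m)$ matrices and $F=\begin{bmatrix}I_n&0\end{bmatrix}\in\mathbb{R}^{n\times(n+m)}$.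
   Context: Here $x_k\in\mathbb{R}^n$, $u_k\in\mathbb{R}^m$, and $A,A_1,\dots,A_M\in\mathbb{R}^{n\times n}$, $B\in\mathbb{R}^{n\times m}$, $C$, $D$ are given real matrices with $\begin{bmatrix}C&D\end{bmatrix}^T\begin{bmatrix}C&D\end{bmatrix}\succ0$. The noises $w_k\in\mathbb{R}^n$ and $\sigma_k(i)\in\mathbb{R}$ ($k\ge0$, $1\le i\le M$) are zero-mean, square-integrable, mutually independent (over all $k$ and $i$), with arbitrary probability distributions, $\mathbf{E}\{w_kw_k^T\}=I$ and $\mathbf{E}\{\sigma_k(i)^2\}=1$. In particular $\mathbf{E}\{\sigma_k(i)w_\ell\}=0$, $\mathbf{E}\{w_kw_\ell^T\}=\delta(k-\ell)I$ and $\mathbf{E}\{\sigma_k(i)\sigma_\ell(i')\}=\delta(i-i')\delta(k-\ell)$. Admissible controllers are (possibly nonlinear) measurable causal state-feedback maps $\mu_k$ for which $u_k$ has finite second moments. $S\succeq0$ ($\succ0$) means symmetric positive semidefinite (definite); $\mathbf{Tr}$ is the trace. "Optimal value" means infimum. *)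

theory Defs
  imports "HOL-Probability.Probability"
begin

text \<open>Block matrices: the index type \<open>'n + 'm\<close> has cardinality \<open>n + m\<close>, the left summand
  indexing the first (state) block and the right summand the second (input) block.\<close>

definition hblock :: "real^'n^'p \<Rightarrow> real^'m^'p \<Rightarrow> real^('n + 'm)^'p" where
  "hblock X Y = (\<chi> r c. case c of Inl i \<Rightarrow> X $ r $ i | Inr j \<Rightarrow> Y $ r $ j)"

definition psd :: "real^'n^'n \<Rightarrow> bool" where
  "psd S \<longleftrightarrow> transpose S = S \<and> (\<forall>v. 0 \<le> v \<bullet> (S *v v))"

definition pos_def :: "real^'n^'n \<Rightarrow> bool" where
  "pos_def S \<longleftrightarrow> transpose S = S \<and> (\<forall>v. v \<noteq> 0 \<longrightarrow> 0 < v \<bullet> (S *v v))"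

text \<open>The whole family consisting of all \<open>w k\<close> and all \<open>\<sigma> k i\<close> with \<open>1 \<le> i \<le> M\<close> is mutually
  independent. Its members have different value types, so this is stated through the
  generated sigma-algebras, as in the unfolding of \<open>indep_vars\<close>; index \<open>Inl k\<close> stands for
  \<open>w k\<close> and \<open>Inr (k, i)\<close> for \<open>\<sigma> k i\<close>.\<close>

definition noises_independent ::
    "'a measure \<Rightarrow> nat \<Rightarrow> (nat \<Rightarrow> 'a \<Rightarrow> real^'n) \<Rightarrow> (nat \<Rightarrow> nat \<Rightarrow> 'a \<Rightarrow> real) \<Rightarrow> bool" where
  "noises_independent P M w \<sigma> \<longleftrightarrow>
     prob_space.indep_sets P
       (\<lambda>s. case s of
          Inl k \<Rightarrow> {w k -` S \<inter> space P | S. S \<in> sets borel}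
        | Inr (k, i) \<Rightarrow> {\<sigma> k i -` S \<inter> space P | S. S \<in> sets borel})
       (UNIV <+> (UNIV \<times> {1..M}))"

text \<open>Admissible policies and the closed loop they generate. The map \<open>\<mu> k\<close> takes the history
  \<open>(x\<^sub>0, \<dots>, x\<^sub>k)\<close>, represented as an element of the product space over \<open>{..k}\<close>. Given \<open>\<mu>\<close> and
  the noises, the processes \<open>x\<close>, \<open>u\<close>, \<open>z\<close> are determined for times \<open>k < N\<close> on \<open>space P\<close>.\<close>

definition admissible_closed_loop ::
    "'a measure \<Rightarrow> nat \<Rightarrow> nat \<Rightarrow> real^'n^'n \<Rightarrow> (nat \<Rightarrow> real^'n^'n) \<Rightarrow> real^'m^'n \<Rightarrow>
     real^'n^'p \<Rightarrow> real^'m^'p \<Rightarrow> (nat \<Rightarrow> 'a \<Rightarrow> real^'n) \<Rightarrow> (nat \<Rightarrow> nat \<Rightarrow> 'a \<Rightarrow> real) \<Rightarrow>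
     (nat \<Rightarrow> (nat \<Rightarrow> real^'n) \<Rightarrow> real^'m) \<Rightarrow>
     (nat \<Rightarrow> 'a \<Rightarrow> real^'n) \<Rightarrow> (nat \<Rightarrow> 'a \<Rightarrow> real^'m) \<Rightarrow> (nat \<Rightarrow> 'a \<Rightarrow> real^'p) \<Rightarrow> bool" where
  "admissible_closed_loop P N M A As B C D w \<sigma> \<mu> x u z \<longleftrightarrow>
     (\<forall>k<N. \<mu> k \<in> borel_measurable (\<Pi>\<^sub>M j\<in>{..k}. borel)) \<and>
     (\<forall>k<N. integrable P (\<lambda>\<omega>. (norm (u k \<omega>))\<^sup>2)) \<and>
     (\<forall>\<omega>\<in>space P. x 0 \<omega> = 0) \<and>
     (\<forall>k<N. \<forall>\<omega>\<in>space P.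
        u k \<omega> = \<mu> k (\<lambda>j\<in>{..k}. x j \<omega>) \<and>
        z k \<omega> = C *v x k \<omega> + D *v u k \<omega> \<and>
        x (Suc k) \<omega> = (A + (\<Sum>i=1..M. \<sigma> k i \<omega> *\<^sub>R As i)) *v x k \<omega> + B *v u k \<omega> + w k \<omega>)"

text \<open>Optimal values are infima, taken in \<^typ>\<open>ereal\<close> so that they are meaningful without
  presupposing feasibility or boundedness.\<close>

definition control_value ::
    "'a measure \<Rightarrow> nat \<Rightarrow> nat \<Rightarrow> real^'n^'n \<Rightarrow> (nat \<Rightarrow> real^'n^'n) \<Rightarrow> real^'m^'n \<Rightarrow>
     real^'n^'p \<Rightarrow> real^'m^'p \<Rightarrow> (nat \<Rightarrow> 'a \<Rightarrow> real^'n) \<Rightarrow> (nat \<Rightarrow> nat \<Rightarrow> 'a \<Rightarrow> real) \<Rightarrow> ereal" where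
  "control_value P N M A As B C D w \<sigma> =
     Inf {ereal (1 / real N * (\<Sum>k<N. \<integral>\<omega>. z k \<omega> \<bullet> z k \<omega> \<partial>P)) | \<mu> x u z.
            admissible_closed_loop P N M A As B C D w \<sigma> \<mu> x u z}"

definition sdp_feasible ::
    "nat \<Rightarrow> nat \<Rightarrow> real^'n^'n \<Rightarrow> (nat \<Rightarrow> real^'n^'n) \<Rightarrow> real^'m^'n \<Rightarrow>
     (nat \<Rightarrow> real^('n + 'm)^('n + 'm)) \<Rightarrow> bool" where
  "sdp_feasible N M A As B V \<longleftrightarrow>
     (let F = hblock (mat 1 :: real^'n^'n) (0 :: real^'m^'n); AB = hblock A B in
       (\<forall>k<N. psd (V k)) \<and>
       (\<forall>k. Suc k < N \<longrightarrow>
          F ** V (Suc k) ** transpose F =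
            AB ** V k ** transpose AB
            + (\<Sum>i=1..M. As i ** F ** V k ** transpose F ** transpose (As i))
            + mat 1))"

definition sdp_value ::
    "nat \<Rightarrow> nat \<Rightarrow> real^'n^'n \<Rightarrow> (nat \<Rightarrow> real^'n^'n) \<Rightarrow> real^'m^'n \<Rightarrow>
     real^'n^'p \<Rightarrow> real^'m^'p \<Rightarrow> ereal" where
  "sdp_value N M A As B C D =
     Inf {ereal (1 / real N * (\<Sum>k<N. trace (hblock C D ** V k ** transpose (hblock C D)))) | V.
            sdp_feasible N M A As B V}"

end

theory Submission
  imports Defs
begin

text \<open>The matrices \<open>V\<^sub>k = E[v\<^sub>k v\<^sub>k\<^sup>T]\<close> with \<open>v\<^sub>k = (x\<^sub>k, u\<^sub>k)\<close> of an admissible closed loop are feasible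
  for the semidefinite program with the same objective value, because the noise at time \<open>k\<close> is
  independent of \<open>v\<^sub>k\<close>. Hence the value of the program is at most the value of the control problem.
  Conversely, let \<open>S\<^sub>k\<close> be the solution of the Riccati recursion with \<open>S\<^sub>N = 0\<close>. Completing the square
  and using that the trace of a product of positive semidefinite matrices is nonnegative, a
  telescoping sum bounds the objective of every feasible \<open>V\<close> from below by the sum of the traces of
  \<open>S\<^sub>1, \<dots>, S\<^sub>N\<close>. This bound needs no constraint on \<open>F V\<^sub>0 F\<^sup>T\<close>, and the linear feedback minimizing the
  stage forms attains it.\<close>

section \<open>Positive semidefinite matrices\<close>

lemma psd_inner_nonneg: "psd S \<Longrightarrow> 0 \<le> v \<bullet> (S *v v)"
  by (simp add: psd_def)

lemma psd_transpose: "psd S \<Longrightarrow> transpose S = S"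
  by (simp add: psd_def)

lemma pos_def_imp_psd: "pos_def S \<Longrightarrow> psd S"
  unfolding pos_def_def psd_def by (metis inner_zero_left less_eq_real_def)

lemma transpose_add: "transpose (A + B) = transpose A + (transpose B :: 'a::semiring_1^'n^'m)"
  by (simp add: transpose_def vec_eq_iff)

lemma psd_0: "psd 0"
  by (simp add: psd_def transpose_def vec_eq_iff)

lemma psd_add: "psd S \<Longrightarrow> psd T \<Longrightarrow> psd (S + T)"
  by (simp add: psd_def transpose_add matrix_vector_mult_add_rdistrib inner_add_right)

lemma psd_sum: "(\<And>i. i \<in> I \<Longrightarrow> psd (S i)) \<Longrightarrow> psd (sum S I)"
  by (induction I rule: infinite_finite_induct) (auto intro: psd_0 psd_add)

lemma pos_def_add_psd: "pos_def S \<Longrightarrow> psd T \<Longrightarrow> pos_def (S + T)"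
  by (simp add: pos_def_def psd_def transpose_add matrix_vector_mult_add_rdistrib inner_add_right
      add_pos_nonneg)

lemma psd_congruence:
  fixes S :: "real^'n^'n" and X :: "real^'n^'m"
  assumes "psd S"
  shows "psd (X ** S ** transpose X)"
  unfolding psd_def
proof (intro conjI allI)
  show "transpose (X ** S ** transpose X) = X ** S ** transpose X"
    using psd_transpose[OF assms] by (simp add: matrix_transpose_mul matrix_mul_assoc)
  fix v
  have "v \<bullet> ((X ** S ** transpose X) *v v) = (v v* X) \<bullet> (S *v (v v* X))"
    by (simp add: matrix_vector_mul_assoc[symmetric] dot_lmul_matrix[symmetric])
  then show "0 \<le> v \<bullet> ((X ** S ** transpose X) *v v)"
    using psd_inner_nonneg[OF assms] by simp
qed

lemma psd_congruence_transpose: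
  fixes S :: "real^'n^'n" and X :: "real^'m^'n"
  shows "psd S \<Longrightarrow> psd (transpose X ** S ** X)"
  using psd_congruence[of S "transpose X"] by simp

section \<open>Trace pairing of positive semidefinite matrices\<close>

text \<open>On the vectors \<open>t e_i + e_j\<close> the quadratic form is a polynomial in t with
  leading coefficient \<open>V $ i $ i\<close>. If that coefficient vanishes, an affine function of
  t stays nonnegative, so its slope \<open>2 * V $ i $ j\<close> is zero for every j.\<close>

lemma psd_row_nonzero_imp_diag_pos:
  fixes V :: "real^'n^'n"
  assumes "psd V" "V $ i \<noteq> 0"
  shows "0 < V $ i $ i"
proof (rule ccontr)
  have sym: "V $ a $ b = V $ b $ a" for a b
    using psd_transpose[OF assms(1)] by (metis transpose_def vec_lambda_beta)
  have form: "0 \<le> t\<^sup>2 * V $ i $ i + 2 * t * V $ i $ j + V $ j $ j" for t j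
  proof -
    have "0 \<le> (t *\<^sub>R axis i 1 + axis j 1) \<bullet> (V *v (t *\<^sub>R axis i 1 + axis j 1))"
      using assms(1) by (rule psd_inner_nonneg)
    also have "\<dots> = t\<^sup>2 * V $ i $ i + 2 * t * V $ i $ j + V $ j $ j"
      by (simp add: matrix_vector_right_distrib matrix_vector_mult_scaleR inner_add_left
          inner_add_right matrix_vector_mult_basis inner_axis' column_def sym[of j i]
          power2_eq_square algebra_simps)
    finally show ?thesis .
  qed
  assume "\<not> 0 < V $ i $ i"
  moreover have "0 \<le> V $ i $ i"
    using form[of 0 i] by simp
  ultimately have 0: "V $ i $ i = 0" by simp
  have "V $ i $ j = 0" for j
  proof (rule ccontr)
    assume "V $ i $ j \<noteq> 0"
    \<comment> \<open>This t solves \<open>2 * t * V $ i $ j + V $ j $ j = -1\<close>, contradicting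
      nonnegativity.\<close>
    then show False
      using form[of "- (V $ j $ j + 1) / (2 * V $ i $ j)" j] 0 by (simp add: field_simps)
  qed
  then show False
    using assms(2) by (simp add: vec_eq_iff)
qed

lemma trace_mult_outer:
  fixes S :: "real^'n^'n" and v :: "real^'n"
  shows "trace (S ** (\<chi> a b. v $ a * v $ b)) = v \<bullet> (S *v v)"
  unfolding trace_def matrix_matrix_mult_def inner_vec_def matrix_vector_mult_def
  by (simp add: sum_distrib_left mult_ac)

text \<open>This is one step of symmetric Gaussian elimination. The form of the reduced matrix at x
  is the minimum over t of the form of V at \<open>x - t e_i\<close>, hence nonnegative.\<close>

lemma psd_sub_pivot:
  fixes V :: "real^'n^'n"
  assumes "psd V" "0 < V $ i $ i"
  shows "psd (V - (1 / V $ i $ i) *\<^sub>R (\<chi> a b. V $ i $ a * V $ i $ b))" (is "psd (V - ?c *\<^sub>R ?O)")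
  unfolding psd_def
proof (intro conjI allI)
  have sym: "V $ a $ b = V $ b $ a" for a b
    using psd_transpose[OF assms(1)] by (metis transpose_def vec_lambda_beta)
  show "transpose (V - ?c *\<^sub>R ?O) = V - ?c *\<^sub>R ?O"
    using psd_transpose[OF assms(1)] by (simp add: transpose_def vec_eq_iff mult.commute)
  fix x :: "real^'n"
  \<comment> \<open>The minimizer of the quadratic
    \<open>t\<^sup>2 * V $ i $ i - 2 * t * (V *v x) $ i\<close>.\<close>
  define t where "t = (V *v x) $ i / V $ i $ i"
  define e where "e = (axis i 1 :: real^'n)"
  have Ve: "V *v e = V $ i"
    by (simp add: e_def matrix_vector_mult_basis column_def vec_eq_iff sym[of _ i])
  have Vix: "V $ i \<bullet> x = (V *v x) $ i"
    by (simp add: matrix_vector_mult_def inner_vec_def)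
  have Ox: "?O *v x = (V $ i \<bullet> x) *\<^sub>R V $ i"
    by (simp add: vec_eq_iff matrix_vector_mult_def inner_vec_def sum_distrib_left mult_ac)
  have "0 \<le> (x - t *\<^sub>R e) \<bullet> (V *v (x - t *\<^sub>R e))"
    using assms(1) by (rule psd_inner_nonneg)
  also have "\<dots> = x \<bullet> (V *v x) - 2 * t * (V *v x) $ i + t\<^sup>2 * V $ i $ i"
    by (simp add: matrix_vector_mult_diff_distrib matrix_vector_mult_scaleR inner_diff_left
        inner_diff_right Ve Vix inner_commute[of x] power2_eq_square algebra_simps)
       (simp add: e_def inner_axis')
  also have "\<dots> = x \<bullet> (V *v x) - ?c * ((V *v x) $ i)\<^sup>2"
    using assms(2) by (simp add: t_def power2_eq_square field_simps)
  also have "\<dots> = x \<bullet> ((V - ?c *\<^sub>R ?O) *v x)"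
    by (simp add: matrix_vector_mult_diff_rdistrib scaleR_matrix_vector_assoc[symmetric] Ox
        inner_diff_right Vix inner_commute[of x "V $ i"] power2_eq_square)
  finally show "0 \<le> x \<bullet> ((V - ?c *\<^sub>R ?O) *v x)" .
qed

lemma trace_scaleR: "trace (c *\<^sub>R X) = c * trace (X :: real^'n^'n)"
  by (simp add: trace_def sum_distrib_left)

lemma matrix_mult_scaleR_right: "X ** (c *\<^sub>R Y) = c *\<^sub>R (X ** (Y :: real^'n^'m))"
  by (simp add: matrix_matrix_mult_def vec_eq_iff sum_distrib_left mult_ac)

lemma matrix_diff_ldistrib: "X ** (Y - Z) = X ** Y - X ** (Z :: real^'n^'m)"
  by (simp add: matrix_matrix_mult_def vec_eq_iff sum_subtractf right_diff_distrib)

lemma matrix_add_rdistrib: "(X + Y) ** Z = X ** Z + Y ** (Z :: real^'n^'m)"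
  by (simp add: matrix_matrix_mult_def vec_eq_iff sum.distrib distrib_right)

lemma matrix_diff_rdistrib: "(X - Y) ** Z = X ** Z - Y ** (Z :: real^'n^'m)"
  by (simp add: matrix_matrix_mult_def vec_eq_iff sum_subtractf left_diff_distrib)

lemma matrix_mult_minus_right: "X ** (- Y) = - (X ** (Y :: real^'n^'m))"
  by (simp add: matrix_matrix_mult_def vec_eq_iff sum_negf)

lemma matrix_sum_rdistrib: "(\<Sum>i\<in>I. X i) ** Z = (\<Sum>i\<in>I. X i ** (Z :: real^'n^'m))"
  by (induction I rule: infinite_finite_induct) (auto simp: matrix_add_rdistrib)

lemma matrix_sum_ldistrib: "Z ** (\<Sum>i\<in>I. X i) = (\<Sum>i\<in>I. Z ** (X i :: real^'n^'m))"
  by (induction I rule: infinite_finite_induct) (auto simp: matrix_add_ldistrib)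

lemma trace_sum: "trace (\<Sum>i\<in>I. X i :: real^'n^'n) = (\<Sum>i\<in>I. trace (X i))"
  by (induction I rule: infinite_finite_induct) (auto simp: trace_add trace_0[simplified])

text \<open>Subtracting the rank-one term of a pivot keeps \<open>V\<close> positive semidefinite, annihilates one
  more row and decreases the trace of the product by a value of the quadratic form of \<open>S\<close>.\<close>

lemma trace_mult_psd_nonneg:
  fixes S V :: "real^'n^'n"
  assumes "psd S" "psd V"
  shows "0 \<le> trace (S ** V)"
  using assms(2)
proof (induction "card {i. V $ i \<noteq> 0}" arbitrary: V rule: less_induct)
  case less
  show ?case
  proof (cases "\<exists>i. V $ i \<noteq> 0")
    case False
    then have "V = 0" by (simp add: vec_eq_iff)
    then show ?thesis by (simp add: trace_def)
  next
    case True
    then obtain i where i: "V $ i \<noteq> 0" by blast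
    define c where "c = 1 / V $ i $ i"
    define W where "W = V - c *\<^sub>R (\<chi> a b. V $ i $ a * V $ i $ b)"
    have pos: "0 < V $ i $ i"
      using psd_row_nonzero_imp_diag_pos less.prems i by blast
    have sym: "V $ a $ b = V $ b $ a" for a b
      using psd_transpose[OF less.prems] by (metis transpose_def vec_lambda_beta)
    have "psd W"
      unfolding W_def c_def using psd_sub_pivot less.prems pos by blast
    moreover have "W $ i = 0"
      using pos by (simp add: W_def c_def vec_eq_iff)
    \<comment> \<open>By symmetry a zero row a of V also has \<open>V $ i $ a = 0\<close>, so the
      rank-one correction leaves that row zero. Together with the new zero row i, the number of
      nonzero rows drops strictly.\<close>
    moreover have "W $ a = 0" if "V $ a = 0" for a
      using that sym[of i a] by (simp add: W_def vec_eq_iff)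
    ultimately have "{a. W $ a \<noteq> 0} \<subset> {a. V $ a \<noteq> 0}"
      using i by blast
    then have "card {a. W $ a \<noteq> 0} < card {a. V $ a \<noteq> 0}"
      by (intro psubset_card_mono) auto
    then have "0 \<le> trace (S ** W)"
      using less.hyps \<open>psd W\<close> by blast
    moreover have "trace (S ** W) = trace (S ** V) - c * (V $ i \<bullet> (S *v V $ i))"
      by (simp add: W_def matrix_diff_ldistrib trace_sub matrix_mult_scaleR_right trace_scaleR
          trace_mult_outer)
    moreover have "0 \<le> c * (V $ i \<bullet> (S *v V $ i))"
      using pos psd_inner_nonneg[OF assms(1)] by (simp add: c_def)
    ultimately show ?thesis by linarith
  qed
qed

text \<open>Cyclicity of the trace: congruence by X and by its transpose are adjoint for the trace
  pairing. This converts forward propagation of moments into backward propagation of costs.\<close>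

lemma trace_mult_congruence:
  fixes S :: "real^'n^'n" and V :: "real^'k^'k" and X :: "real^'k^'n"
  shows "trace (S ** (X ** V ** transpose X)) = trace ((transpose X ** S ** X) ** V)"
  using trace_mul_sym[of "S ** X ** V" "transpose X"] by (simp add: matrix_mul_assoc)

section \<open>The Riccati recursion\<close>

definition joint_vec :: "real^'n \<Rightarrow> real^'m \<Rightarrow> real^('n + 'm)" where
  "joint_vec x u = (\<chi> c. case c of Inl i \<Rightarrow> x $ i | Inr j \<Rightarrow> u $ j)"

lemma sum_UNIV_Plus:
  fixes g :: "'n::finite + 'm::finite \<Rightarrow> 'a::comm_monoid_add"
  shows "(\<Sum>c\<in>UNIV. g c) = (\<Sum>i\<in>UNIV. g (Inl i)) + (\<Sum>j\<in>UNIV. g (Inr j))"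
  by (simp add: UNIV_Plus_UNIV[symmetric] sum.Plus del: UNIV_Plus_UNIV)

lemma hblock_joint_vec: "hblock X Y *v joint_vec x u = X *v x + Y *v u"
  by (simp add: vec_eq_iff matrix_vector_mult_def hblock_def joint_vec_def sum_UNIV_Plus)

lemma joint_vec_add: "joint_vec x u + joint_vec y v = joint_vec (x + y) (u + v)"
  by (auto simp: joint_vec_def vec_eq_iff split: sum.split)

lemma joint_vec_eq_0_iff: "joint_vec x u = 0 \<longleftrightarrow> x = 0 \<and> u = 0"
  by (auto simp: joint_vec_def vec_eq_iff split: sum.splits) 

lemma joint_vec_cases: obtains x u where "v = joint_vec x u"
proof
  show "v = joint_vec (\<chi> i. v $ Inl i) (\<chi> j. v $ Inr j)"
    by (auto simp: joint_vec_def vec_eq_iff split: sum.split)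
qed

lemma transpose_hblock_mult:
  fixes X :: "real^'n^'p" and Y :: "real^'m^'p"
  shows "transpose (hblock X Y) *v v = joint_vec (transpose X *v v) (transpose Y *v v)"
  by (auto simp: joint_vec_def hblock_def vec_eq_iff vector_matrix_mult_def split: sum.split)

text \<open>The column block matrix [I; K], whose range is the graph of K. It is written as a
  transpose because \<open>hblock\<close> only places blocks side by side.\<close>

definition graph_matrix :: "real^'n^'m \<Rightarrow> real^'n^('n + 'm)" where
  "graph_matrix K = transpose (hblock (mat 1) (transpose K))"

lemma graph_matrix_mult: "graph_matrix K *v x = joint_vec x (K *v x)"
  by (simp only: graph_matrix_def transpose_hblock_mult transpose_transpose transpose_mat
      matrix_vector_mul_lid)

text \<open>The input block of H is positive definite, hence invertible, so the stationarity
  condition in u has a solution linear in x. Completing the square around it shows that this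
  solution is the minimum, for all x with the same K.\<close>

lemma pos_def_minimizing_gain:
  fixes H :: "real^('n::finite + 'm::finite)^('n + 'm)"
  assumes "pos_def H"
  obtains K :: "real^'n^'m" where
    "\<And>x u. joint_vec x (K *v x) \<bullet> (H *v joint_vec x (K *v x)) \<le> joint_vec x u \<bullet> (H *v joint_vec x u)"
proof -
  \<comment> \<open>E and J embed states and inputs into the stacked space.\<close>
  define E where "E = transpose (hblock (mat 1 :: real^'n^'n) (0 :: real^'m^'n))"
  define J where "J = transpose (hblock (0 :: real^'n^'m) (mat 1 :: real^'m^'m))"
  have E: "E *v x = joint_vec x 0" for x
    by (simp only: E_def transpose_hblock_mult transpose_mat matrix_vector_mul_lid) simp
  have J: "J *v u = joint_vec 0 u" for u
    by (simp only: J_def transpose_hblock_mult transpose_mat matrix_vector_mul_lid) simp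
  define R where "R = transpose J ** H ** J"
  \<comment> \<open>A trivial kernel suffices for invertibility of the square matrix R.\<close>
  have "u = 0" if "R *v u = 0" for u
  proof (rule ccontr)
    assume "u \<noteq> 0"
    then have "0 < (J *v u) \<bullet> (H *v (J *v u))"
      using assms by (simp add: pos_def_def J joint_vec_eq_0_iff)
    also have "\<dots> = u \<bullet> (R *v u)"
      by (simp add: R_def matrix_vector_mul_assoc[symmetric] dot_lmul_matrix[symmetric])
         (metis dot_lmul_matrix inner_commute)
    finally show False using that by simp
  qed
  then obtain R' where "R' ** R = mat 1"
    using matrix_left_invertible_ker[of R] by blast
  then have R': "R ** R' = mat 1"
    by (simp add: matrix_left_right_inverse)
  \<comment> \<open>The solution of \<open>transpose J ** H ** (E + J ** K) = 0\<close>, the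
    stationarity condition in the input.\<close>
  define K where "K = - (R' ** transpose J ** H ** E)"
  have sym: "a \<bullet> (H *v b) = b \<bullet> (H *v a)" for a b
    using assms by (metis pos_def_def dot_lmul_matrix inner_commute transpose_matrix_vector)
  have "joint_vec x (K *v x) \<bullet> (H *v joint_vec x (K *v x)) \<le> joint_vec x u \<bullet> (H *v joint_vec x u)" for x u
  proof -
    define e where "e = joint_vec x (K *v x)"
    define d where "d = u - K *v x"
    have e: "e = E *v x + J *v (K *v x)"
      by (simp add: e_def E J joint_vec_add)
    have "transpose J *v (H *v e) = (transpose J ** H ** E) *v x + (R ** K) *v x"
      unfolding e R_def
      by (simp only: matrix_vector_right_distrib matrix_vector_mul_assoc matrix_mul_assoc)
    also have "R ** K = - (R ** R' ** (transpose J ** H ** E))"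
      by (simp only: K_def matrix_mult_minus_right matrix_mul_assoc)
    also have "(transpose J ** H ** E) *v x + - (R ** R' ** (transpose J ** H ** E)) *v x = 0"
      by (simp only: R' matrix_mul_lid matrix_vector_mult_add_rdistrib[symmetric]) simp
    finally have 0: "transpose J *v (H *v e) = 0" .
    \<comment> \<open>Stationarity removes the cross term, so the form at \<open>e + J *v d\<close>
      exceeds the form at e by the nonnegative form at \<open>J *v d\<close>.\<close>
    have "(J *v d) \<bullet> (H *v e) = 0"
      using 0 by (metis dot_lmul_matrix inner_commute inner_zero_left transpose_matrix_vector)
    moreover have "joint_vec x u = e + J *v d"
      by (simp add: e_def J d_def joint_vec_add)
    moreover have "0 \<le> (J *v d) \<bullet> (H *v (J *v d))"
      using pos_def_imp_psd[OF assms] by (rule psd_inner_nonneg)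
    ultimately show ?thesis
      using sym[of e "J *v d"]
      by (simp add: e_def[symmetric] matrix_vector_right_distrib inner_add_left inner_add_right)
  qed
  then show ?thesis by (rule that)
qed

section \<open>The stage form, its minimizing gain and the Riccati map\<close>

locale lq_problem =
  fixes N M :: nat
    and A :: "real^'n^'n" and As :: "nat \<Rightarrow> real^'n^'n" and B :: "real^'m^'n"
    and C :: "real^'n^'p" and D :: "real^'m^'p"
  assumes pos_def_cost: "pos_def (transpose (hblock C D) ** hblock C D)"
begin

abbreviation F :: "real^('n + 'm)^'n" where
  "F \<equiv> hblock (mat 1) 0"

abbreviation L :: "real^('n + 'm)^'p" where
  "L \<equiv> hblock C D"

abbreviation AB :: "real^('n + 'm)^'n" where
  "AB \<equiv> hblock A B"

text \<open>The matrix of the Bellman quadratic form: running cost plus the expected S-weighted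
  square of the next state, without the constant \<open>trace S\<close> caused by the additive
  noise.\<close>

definition stage_form :: "real^'n^'n \<Rightarrow> real^('n + 'm)^('n + 'm)" where
  "stage_form S = transpose L ** L + transpose AB ** S ** AB
     + (\<Sum>i=1..M. transpose (As i ** F) ** S ** (As i ** F))"

text \<open>The right side of the program's constraint; it is the second moment of the next state
  when V is that of the stacked vector.\<close>

definition next_moment :: "real^('n + 'm)^('n + 'm) \<Rightarrow> real^'n^'n" where
  "next_moment V = AB ** V ** transpose AB
     + (\<Sum>i=1..M. As i ** F ** V ** transpose F ** transpose (As i)) + mat 1"

text \<open>Each summand of \<open>stage_form\<close> is adjoint to one of the cost or of
  \<open>next_moment\<close>. The term \<open>- trace S\<close> compensates for the constant
  \<open>mat 1\<close> in \<open>next_moment\<close>.\<close>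

lemma trace_stage_form:
  "trace (stage_form S ** V)
     = trace (L ** V ** transpose L) + trace (S ** next_moment V) - trace S"
proof -
  have L: "trace (transpose L ** L ** V) = trace (L ** V ** transpose L)"
    using trace_mult_congruence[of "mat 1" L V] by simp
  have AB: "trace (transpose AB ** S ** AB ** V) = trace (S ** (AB ** V ** transpose AB))"
    by (simp only: trace_mult_congruence)
  have As: "trace (transpose (As i ** F) ** S ** (As i ** F) ** V)
      = trace (S ** (As i ** F ** V ** transpose F ** transpose (As i)))" for i
    using trace_mult_congruence[of S "As i ** F" V]
    by (simp add: matrix_transpose_mul matrix_mul_assoc)
  show ?thesis
    unfolding stage_form_def next_moment_def
    by (simp only: matrix_add_rdistrib matrix_add_ldistrib matrix_sum_rdistrib
        matrix_sum_ldistrib trace_add trace_sum L AB As matrix_mul_rid)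
qed

text \<open>The running cost is positive definite by assumption; the remaining summands are
  congruences of S and can only add to it.\<close>

lemma pos_def_stage_form:
  assumes "psd S"
  shows "pos_def (stage_form S)"
  unfolding stage_form_def add.assoc
  by (intro pos_def_add_psd pos_def_cost psd_add psd_sum psd_congruence_transpose assms)

text \<open>The optimal feedback gain, selected by its minimality instead of an explicit formula
  with an inverse; existence for positive semidefinite S comes from
  \<open>pos_def_minimizing_gain\<close>.\<close>

definition gain :: "real^'n^'n \<Rightarrow> real^'n^'m" where
  "gain S = (SOME K. \<forall>x u.
     joint_vec x (K *v x) \<bullet> (stage_form S *v joint_vec x (K *v x))
       \<le> joint_vec x u \<bullet> (stage_form S *v joint_vec x u))"

lemma gain_minimizes:
  assumes "psd S"
  shows "joint_vec x (gain S *v x) \<bullet> (stage_form S *v joint_vec x (gain S *v x))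
    \<le> joint_vec x u \<bullet> (stage_form S *v joint_vec x u)"
proof -
  have "\<exists>K. \<forall>x u. joint_vec x (K *v x) \<bullet> (stage_form S *v joint_vec x (K *v x))
       \<le> joint_vec x u \<bullet> (stage_form S *v joint_vec x u)"
    using pos_def_minimizing_gain[OF pos_def_stage_form[OF assms]] by metis
  from someI_ex[OF this] show ?thesis
    unfolding gain_def by blast
qed

text \<open>The stage form restricted to the graph of the minimizing gain. Its quadratic form is the
  minimum over u, and as a congruence it is visibly positive semidefinite.\<close>

definition riccati :: "real^'n^'n \<Rightarrow> real^'n^'n" where
  "riccati S = transpose (graph_matrix (gain S)) ** stage_form S ** graph_matrix (gain S)"

lemma psd_riccati: "psd S \<Longrightarrow> psd (riccati S)"
  unfolding riccati_def
  by (rule psd_congruence_transpose[OF pos_def_imp_psd[OF pos_def_stage_form]])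

lemma trace_riccati:
  "trace (riccati S ** X)
     = trace (stage_form S ** (graph_matrix (gain S) ** X ** transpose (graph_matrix (gain S))))"
  by (simp only: riccati_def trace_mult_congruence)

text \<open>The form of \<open>stage_form S - transpose F ** riccati S ** F\<close> at (x, u) is the
  excess of the stage cost of u over its minimum, so this matrix is positive semidefinite and pairs
  nonnegatively with V.\<close>

lemma trace_riccati_le:
  assumes "psd S" "psd V"
  shows "trace (riccati S ** (F ** V ** transpose F)) \<le> trace (stage_form S ** V)"
proof -
  have FRF: "psd (transpose F ** riccati S ** F)"
    by (intro psd_congruence_transpose psd_riccati assms)
  have "psd (stage_form S - transpose F ** riccati S ** F)"
    unfolding psd_def
  proof (intro conjI allI)
    show "transpose (stage_form S - transpose F ** riccati S ** F)
        = stage_form S - transpose F ** riccati S ** F"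
      using psd_transpose[OF FRF] psd_transpose[OF pos_def_imp_psd[OF pos_def_stage_form[OF assms(1)]]]
      by (simp add: transpose_def vec_eq_iff)
    fix v :: "real^('n + 'm)"
    obtain x u where v: "v = joint_vec x u" by (rule joint_vec_cases)
    have "v \<bullet> ((transpose F ** riccati S ** F) *v v) = (F *v v) \<bullet> (riccati S *v (F *v v))"
      by (simp add: matrix_vector_mul_assoc[symmetric])
         (metis dot_lmul_matrix inner_commute)
    also have "F *v v = x"
      by (simp add: v hblock_joint_vec)
    also have "x \<bullet> (riccati S *v x)
        = (graph_matrix (gain S) *v x) \<bullet> (stage_form S *v (graph_matrix (gain S) *v x))"
      by (simp add: riccati_def matrix_vector_mul_assoc[symmetric])
         (metis dot_lmul_matrix inner_commute)
    also have "\<dots> \<le> v \<bullet> (stage_form S *v v)"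
      unfolding graph_matrix_mult v by (rule gain_minimizes[OF assms(1)])
    finally show "0 \<le> v \<bullet> ((stage_form S - transpose F ** riccati S ** F) *v v)"
      by (simp add: matrix_vector_mult_diff_rdistrib inner_diff_right)
  qed
  from trace_mult_psd_nonneg[OF this assms(2)] show ?thesis
    by (simp add: matrix_diff_rdistrib trace_sub trace_mult_congruence)
qed

text \<open>\<open>cost_to_go j\<close> is the value function with \<open>j\<close> stages left.\<close>

primrec cost_to_go :: "nat \<Rightarrow> real^'n^'n" where
  "cost_to_go 0 = 0"
| "cost_to_go (Suc j) = riccati (cost_to_go j)"

lemma psd_cost_to_go: "psd (cost_to_go j)"
  by (induction j) (simp_all add: psd_0 psd_riccati)

text \<open>Each term is the price of the unit-covariance noise injected at time k, weighted by the
  cost-to-go of the stages after k. The last term is zero.\<close>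

definition opt_value :: real where
  "opt_value = (\<Sum>k<N. trace (cost_to_go (N - Suc k)))"

section \<open>Lower bound for the program and its attainment\<close>

lemma sdp_feasible_next_moment:
  "sdp_feasible N M A As B V \<longleftrightarrow>
     (\<forall>k<N. psd (V k)) \<and>
     (\<forall>k. Suc k < N \<longrightarrow> F ** V (Suc k) ** transpose F = next_moment (V k))"
  by (simp add: sdp_feasible_def next_moment_def Let_def)

lemma opt_value_le_sdp:
  assumes "sdp_feasible N M A As B V"
  shows "opt_value \<le> (\<Sum>k<N. trace (L ** V k ** transpose L))"
proof -
  \<comment> \<open>The telescoping potential: the cost-to-go at time k paired with the state block
    of \<open>V k\<close>.\<close>
  define a where "a k = trace (cost_to_go (N - k) ** (F ** V k ** transpose F))" for k
  have step: "a k - a (Suc k) + trace (cost_to_go (N - Suc k)) \<le> trace (L ** V k ** transpose L)"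
    if "k < N" for k
  proof -
    let ?S = "cost_to_go (N - Suc k)"
    have "psd (V k)"
      using assms that by (simp add: sdp_feasible_next_moment)
    then have "trace (riccati ?S ** (F ** V k ** transpose F)) \<le> trace (stage_form ?S ** V k)"
      by (intro trace_riccati_le psd_cost_to_go)
    moreover have "riccati ?S = cost_to_go (N - k)"
      using that by (metis Suc_diff_Suc cost_to_go.simps(2))
    moreover have "trace (?S ** next_moment (V k)) = a (Suc k)"
    proof (cases "Suc k < N")
      case True
      then show ?thesis
        using assms by (simp add: sdp_feasible_next_moment a_def)
    next
      \<comment> \<open>Here \<open>Suc k = N\<close>, where no constraint ties \<open>V N\<close>
        to \<open>V k\<close>; both sides vanish because \<open>cost_to_go 0 = 0\<close>.\<close>
      case False
      then show ?thesis
        by (simp add: a_def)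
    qed
    ultimately show ?thesis
      by (simp add: a_def trace_stage_form)
  qed
  have "a 0 - a N + opt_value = (\<Sum>k<N. a k - a (Suc k) + trace (cost_to_go (N - Suc k)))"
    by (simp add: opt_value_def sum.distrib sum_lessThan_telescope')
  also have "\<dots> \<le> (\<Sum>k<N. trace (L ** V k ** transpose L))"
    by (intro sum_mono step) simp
  finally have "a 0 - a N + opt_value \<le> (\<Sum>k<N. trace (L ** V k ** transpose L))" .
  \<comment> \<open>The program leaves the state block of \<open>V 0\<close> free, so only the sign
    of the initial potential is available, which is the direction required.\<close>
  moreover have "0 \<le> a 0"
  proof (cases "N = 0")
    case True
    then show ?thesis by (simp add: a_def trace_0[simplified])
  next
    case False
    then have "psd (V 0)"
      using assms by (simp add: sdp_feasible_next_moment)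
    then show ?thesis
      unfolding a_def by (intro trace_mult_psd_nonneg psd_congruence psd_cost_to_go)
  qed
  moreover have "a N = 0"
    by (simp add: a_def trace_0[simplified])
  ultimately show ?thesis by linarith
qed

abbreviation opt_gain :: "nat \<Rightarrow> real^'n^'m" where
  "opt_gain k \<equiv> gain (cost_to_go (N - Suc k))"

text \<open>When \<open>V k\<close> is the moment of a stacked vector on the graph of the minimizing
  gain, \<open>trace_riccati\<close> replaces the inequality of the lower bound by an equality. The
  zero initial moment makes the first potential vanish.\<close>

lemma opt_value_attained:
  assumes "X 0 = 0"
    and V: "\<And>k. k < N \<Longrightarrow> V k = graph_matrix (opt_gain k) ** X k ** transpose (graph_matrix (opt_gain k))"
    and X: "\<And>k. k < N \<Longrightarrow> X (Suc k) = next_moment (V k)"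
  shows "(\<Sum>k<N. trace (L ** V k ** transpose L)) = opt_value"
proof -
  define a where "a k = trace (cost_to_go (N - k) ** X k)" for k
  have step: "trace (L ** V k ** transpose L) = a k - a (Suc k) + trace (cost_to_go (N - Suc k))"
    if "k < N" for k
  proof -
    let ?S = "cost_to_go (N - Suc k)"
    have "trace (riccati ?S ** X k) = trace (stage_form ?S ** V k)"
      by (simp add: trace_riccati V[OF that])
    moreover have "riccati ?S = cost_to_go (N - k)"
      using that by (metis Suc_diff_Suc cost_to_go.simps(2))
    ultimately show ?thesis
      by (simp add: a_def trace_stage_form X[OF that])
  qed
  have "(\<Sum>k<N. trace (L ** V k ** transpose L))
      = (\<Sum>k<N. a k - a (Suc k) + trace (cost_to_go (N - Suc k)))"
    by (intro sum.cong step) auto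
  also have "\<dots> = a 0 - a N + opt_value"
    by (simp add: opt_value_def sum.distrib sum_lessThan_telescope')
  also have "\<dots> = opt_value"
    using assms(1) by (simp add: a_def trace_0[simplified])
  finally show ?thesis .
qed

end

section \<open>Second moments\<close>

definition square_integrable :: "'a measure \<Rightarrow> ('a \<Rightarrow> 'b::euclidean_space) \<Rightarrow> bool" where
  "square_integrable P v \<longleftrightarrow> v \<in> borel_measurable P \<and> integrable P (\<lambda>\<omega>. (norm (v \<omega>))\<^sup>2)"

definition second_moment :: "'a measure \<Rightarrow> ('a \<Rightarrow> real^'k) \<Rightarrow> real^'k^'k" where
  "second_moment P v = (\<chi> r c. \<integral>\<omega>. v \<omega> $ r * v \<omega> $ c \<partial>P)"

lemma square_integrable_mult:
  fixes f g :: "'a \<Rightarrow> real"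
  assumes "square_integrable P f" "square_integrable P g"
  shows "integrable P (\<lambda>\<omega>. f \<omega> * g \<omega>)"
proof (rule Bochner_Integration.integrable_bound)
  show "integrable P (\<lambda>\<omega>. (norm (f \<omega>))\<^sup>2 + (norm (g \<omega>))\<^sup>2)"
    using assms by (auto simp: square_integrable_def)
  show "(\<lambda>\<omega>. f \<omega> * g \<omega>) \<in> borel_measurable P"
    using assms by (auto simp: square_integrable_def)
  have "\<bar>a * b\<bar> \<le> a\<^sup>2 + b\<^sup>2" for a b :: real
  proof -
    have "0 \<le> (\<bar>a\<bar> - \<bar>b\<bar>)\<^sup>2" "0 \<le> \<bar>a\<bar> * \<bar>b\<bar>" by simp_all
    then show ?thesis
      unfolding power2_diff power2_abs abs_mult by linarith
  qed
  then show "AE \<omega> in P. norm (f \<omega> * g \<omega>) \<le> norm ((norm (f \<omega>))\<^sup>2 + (norm (g \<omega>))\<^sup>2)"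
    by simp
qed

lemma square_integrable_bounded_linear:
  assumes "bounded_linear h" "square_integrable P v"
  shows "square_integrable P (\<lambda>\<omega>. h (v \<omega>))"
  unfolding square_integrable_def
proof
  obtain K where K: "\<And>x. norm (h x) \<le> norm x * K"
    using bounded_linear.bounded[OF assms(1)] by blast
  show meas: "(\<lambda>\<omega>. h (v \<omega>)) \<in> borel_measurable P"
    using assms by (auto simp: square_integrable_def
        intro: borel_measurable_continuous_on linear_continuous_on)
  show "integrable P (\<lambda>\<omega>. (norm (h (v \<omega>)))\<^sup>2)"
  proof (rule Bochner_Integration.integrable_bound)
    show "integrable P (\<lambda>\<omega>. K\<^sup>2 * (norm (v \<omega>))\<^sup>2)"
      using assms by (auto simp: square_integrable_def)
    show "(\<lambda>\<omega>. (norm (h (v \<omega>)))\<^sup>2) \<in> borel_measurable P"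
      using meas by measurable
    have "(norm (h x))\<^sup>2 \<le> (norm x * K)\<^sup>2" for x
      using K by (intro power_mono) auto
    then show "AE \<omega> in P. norm ((norm (h (v \<omega>)))\<^sup>2) \<le> norm (K\<^sup>2 * (norm (v \<omega>))\<^sup>2)"
      by (simp add: power_mult_distrib mult.commute)
  qed
qed

lemma square_integrable_add:
  assumes "square_integrable P f" "square_integrable P g"
  shows "square_integrable P (\<lambda>\<omega>. f \<omega> + g \<omega>)"
  unfolding square_integrable_def
proof
  show meas: "(\<lambda>\<omega>. f \<omega> + g \<omega>) \<in> borel_measurable P"
    using assms by (auto simp: square_integrable_def)
  show "integrable P (\<lambda>\<omega>. (norm (f \<omega> + g \<omega>))\<^sup>2)"
  proof (rule Bochner_Integration.integrable_bound)
    show "integrable P (\<lambda>\<omega>. 2 * (norm (f \<omega>))\<^sup>2 + 2 * (norm (g \<omega>))\<^sup>2)"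
      using assms by (auto simp: square_integrable_def)
    show "(\<lambda>\<omega>. (norm (f \<omega> + g \<omega>))\<^sup>2) \<in> borel_measurable P"
      using meas by measurable
    have "(norm (a + b))\<^sup>2 \<le> 2 * (norm a)\<^sup>2 + 2 * (norm b)\<^sup>2" for a b :: 'b
    proof -
      have "0 \<le> (norm (a - b))\<^sup>2" by simp
      then show ?thesis
        by (simp add: power2_norm_eq_inner inner_add_left inner_add_right inner_diff_left
            inner_diff_right inner_commute)
    qed
    then show "AE \<omega> in P. norm ((norm (f \<omega> + g \<omega>))\<^sup>2) \<le> norm (2 * (norm (f \<omega>))\<^sup>2 + 2 * (norm (g \<omega>))\<^sup>2)"
      by simp
  qed
qed

lemma square_integrable_cong:
  assumes "\<And>\<omega>. \<omega> \<in> space P \<Longrightarrow> f \<omega> = g \<omega>"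
  shows "square_integrable P f \<longleftrightarrow> square_integrable P g"
  unfolding square_integrable_def
  using assms by (intro conj_cong measurable_cong Bochner_Integration.integrable_cong) auto

lemma second_moment_cong:
  assumes "\<And>\<omega>. \<omega> \<in> space P \<Longrightarrow> f \<omega> = g \<omega>"
  shows "second_moment P f = second_moment P g"
  unfolding second_moment_def vec_eq_iff
  using assms by (auto intro!: Bochner_Integration.integral_cong)

section \<open>Second-moment matrices and linear images\<close>

lemma square_integrable_matrix_mult:
  fixes X :: "real^'k^'l"
  shows "square_integrable P v \<Longrightarrow> square_integrable P (\<lambda>\<omega>. X *v v \<omega>)"
  by (rule square_integrable_bounded_linear[OF matrix_vector_mul_bounded_linear])

lemma square_integrable_vec_nth:
  "square_integrable P v \<Longrightarrow> square_integrable P (\<lambda>\<omega>. v \<omega> $ i)"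
  by (rule square_integrable_bounded_linear[OF bounded_linear_vec_nth])

lemma square_integrable_joint_vec:
  fixes x :: "'a \<Rightarrow> real^'n" and u :: "'a \<Rightarrow> real^'m"
  assumes "square_integrable P x" "square_integrable P u"
  shows "square_integrable P (\<lambda>\<omega>. joint_vec (x \<omega>) (u \<omega>))"
proof -
  have "joint_vec (x \<omega>) (u \<omega>)
      = transpose (hblock (mat 1 :: real^'n^'n) (0 :: real^'m^'n)) *v x \<omega>
        + transpose (hblock (0 :: real^'n^'m) (mat 1 :: real^'m^'m)) *v u \<omega>" for \<omega>
    by (simp only: transpose_hblock_mult transpose_mat matrix_vector_mul_lid)
       (simp add: joint_vec_add)
  then show ?thesis
    by (simp only: square_integrable_add square_integrable_matrix_mult assms)
qed

lemma integrable_vec_nth_mult: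
  fixes v :: "'a \<Rightarrow> real^'k"
  shows "square_integrable P v \<Longrightarrow> integrable P (\<lambda>\<omega>. v \<omega> $ r * v \<omega> $ c)"
  by (rule square_integrable_mult[OF square_integrable_vec_nth square_integrable_vec_nth])

lemma second_moment_matrix_mult:
  fixes X :: "real^'k^'l"
  assumes "square_integrable P v"
  shows "second_moment P (\<lambda>\<omega>. X *v v \<omega>) = X ** second_moment P v ** transpose X"
proof -
  have "(\<integral>\<omega>. (X *v v \<omega>) $ r * (X *v v \<omega>) $ c \<partial>P)
      = (\<Sum>b\<in>UNIV. \<Sum>a\<in>UNIV. X $ r $ a * X $ c $ b * (\<integral>\<omega>. v \<omega> $ a * v \<omega> $ b \<partial>P))" for r c
  proof -
    have "(X *v v \<omega>) $ r * (X *v v \<omega>) $ c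
        = (\<Sum>b\<in>UNIV. \<Sum>a\<in>UNIV. X $ r $ a * X $ c $ b * (v \<omega> $ a * v \<omega> $ b))" for \<omega>
      unfolding matrix_vector_mult_def vec_lambda_beta sum_product
      by (subst sum.swap) (simp add: mult_ac)
    then show ?thesis
      by (simp add: integrable_vec_nth_mult[OF assms])
  qed
  then show ?thesis
    by (simp add: vec_eq_iff second_moment_def matrix_matrix_mult_def transpose_def
        sum_distrib_left sum_distrib_right mult_ac)
qed

lemma trace_second_moment:
  assumes "square_integrable P v"
  shows "trace (second_moment P v) = (\<integral>\<omega>. v \<omega> \<bullet> v \<omega> \<partial>P)"
  by (simp add: trace_def second_moment_def inner_vec_def integrable_vec_nth_mult[OF assms])

lemma inner_second_moment:
  assumes "square_integrable P v"
  shows "x \<bullet> (second_moment P v *v x) = (\<integral>\<omega>. (x \<bullet> v \<omega>)\<^sup>2 \<partial>P)"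
proof -
  have "(\<integral>\<omega>. (x \<bullet> v \<omega>)\<^sup>2 \<partial>P)
      = (\<integral>\<omega>. (\<Sum>r\<in>UNIV. \<Sum>c\<in>UNIV. x $ r * x $ c * (v \<omega> $ r * v \<omega> $ c)) \<partial>P)"
    by (simp add: inner_vec_def power2_eq_square sum_product mult_ac)
  also have "\<dots> = (\<Sum>r\<in>UNIV. \<Sum>c\<in>UNIV. x $ r * x $ c * (\<integral>\<omega>. v \<omega> $ r * v \<omega> $ c \<partial>P))"
    by (simp add: integrable_vec_nth_mult[OF assms])
  also have "\<dots> = x \<bullet> (second_moment P v *v x)"
    by (simp add: inner_vec_def matrix_vector_mult_def second_moment_def sum_distrib_left mult_ac)
  finally show ?thesis ..
qed

lemma psd_second_moment:
  assumes "square_integrable P v"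
  shows "psd (second_moment P v)"
  unfolding psd_def inner_second_moment[OF assms]
  by (auto simp: second_moment_def transpose_def vec_eq_iff mult.commute)

text \<open>After expanding the product of two entries, independence factors each expectation into
  one of the \<open>f\<close> and one of the \<open>s\<close>, and orthonormality keeps only the
  diagonal pairs.\<close>

lemma (in prob_space)
  fixes s :: "'t \<Rightarrow> 'a \<Rightarrow> real" and f :: "'t \<Rightarrow> 'a \<Rightarrow> real^'n"
  assumes f: "\<And>t. t \<in> T \<Longrightarrow> square_integrable M (f t)"
    and s: "\<And>t. t \<in> T \<Longrightarrow> square_integrable M (s t)"
    and indep: "\<And>t t' r c. t \<in> T \<Longrightarrow> t' \<in> T \<Longrightarrow>
      indep_var borel (\<lambda>\<omega>. f t \<omega> $ r * f t' \<omega> $ c) borel (\<lambda>\<omega>. s t \<omega> * s t' \<omega>)"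
    and orthonormal: "\<And>t t'. t \<in> T \<Longrightarrow> t' \<in> T \<Longrightarrow>
      expectation (\<lambda>\<omega>. s t \<omega> * s t' \<omega>) = (if t = t' then 1 else 0)"
    and "finite T"
  shows square_integrable_orthonormal_combination:
      "square_integrable M (\<lambda>\<omega>. \<Sum>t\<in>T. s t \<omega> *\<^sub>R f t \<omega>)" (is "square_integrable M ?v")
    and second_moment_orthonormal_combination:
      "second_moment M (\<lambda>\<omega>. \<Sum>t\<in>T. s t \<omega> *\<^sub>R f t \<omega>) = (\<Sum>t\<in>T. second_moment M (f t))"
proof -
  have ff: "integrable M (\<lambda>\<omega>. f t \<omega> $ r * f t' \<omega> $ c)" if "t \<in> T" "t' \<in> T" for t t' r c
    using that by (intro square_integrable_mult square_integrable_vec_nth f)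
  have ss: "integrable M (\<lambda>\<omega>. s t \<omega> * s t' \<omega>)" if "t \<in> T" "t' \<in> T" for t t'
    using that by (intro square_integrable_mult s)
  have expand: "?v \<omega> $ r * ?v \<omega> $ c
      = (\<Sum>t\<in>T. \<Sum>t'\<in>T. (f t \<omega> $ r * f t' \<omega> $ c) * (s t \<omega> * s t' \<omega>))" for \<omega> r c
    unfolding sum_component vector_scaleR_component sum_product real_scaleR_def
    by (simp only: mult_ac)
  \<comment> \<open>A product of four square-integrable functions need not be integrable;
    independence of the two integrable pair products makes it so.\<close>
  have int: "integrable M (\<lambda>\<omega>. (f t \<omega> $ r * f t' \<omega> $ c) * (s t \<omega> * s t' \<omega>))"
    if "t \<in> T" "t' \<in> T" for t t' r c
    using that by (intro indep_var_integrable indep ff ss)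
  have intv: "integrable M (\<lambda>\<omega>. ?v \<omega> $ r * ?v \<omega> $ c)" for r c
    unfolding expand by (intro Bochner_Integration.integrable_sum int)
  show "square_integrable M ?v"
    unfolding square_integrable_def
  proof
    show "?v \<in> borel_measurable M"
      using f s by (intro borel_measurable_sum borel_measurable_scaleR) (auto simp: square_integrable_def)
    show "integrable M (\<lambda>\<omega>. (norm (?v \<omega>))\<^sup>2)"
      unfolding power2_norm_eq_inner inner_vec_def inner_real_def
      by (intro Bochner_Integration.integrable_sum intv)
  qed
  have "expectation (\<lambda>\<omega>. ?v \<omega> $ r * ?v \<omega> $ c) = (\<Sum>t\<in>T. expectation (\<lambda>\<omega>. f t \<omega> $ r * f t \<omega> $ c))"
    for r c
  proof -
    have "expectation (\<lambda>\<omega>. ?v \<omega> $ r * ?v \<omega> $ c)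
        = (\<Sum>t\<in>T. \<Sum>t'\<in>T. expectation (\<lambda>\<omega>. (f t \<omega> $ r * f t' \<omega> $ c) * (s t \<omega> * s t' \<omega>)))"
      unfolding expand
      by (subst Bochner_Integration.integral_sum)
         (intro Bochner_Integration.integrable_sum int sum.cong refl Bochner_Integration.integral_sum;
           assumption)+
    also have "\<dots> = (\<Sum>t\<in>T. \<Sum>t'\<in>T. expectation (\<lambda>\<omega>. f t \<omega> $ r * f t' \<omega> $ c) * (if t = t' then 1 else 0))"
      by (intro sum.cong refl)
         (simp only: indep_var_lebesgue_integral[OF indep ff ss] orthonormal)
    also have "\<dots> = (\<Sum>t\<in>T. expectation (\<lambda>\<omega>. f t \<omega> $ r * f t \<omega> $ c))"
      using \<open>finite T\<close> by (simp add: if_distrib sum.delta cong: if_cong)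
    finally show ?thesis .
  qed
  then show "second_moment M ?v = (\<Sum>t\<in>T. second_moment M (f t))"
    by (simp add: second_moment_def vec_eq_iff)
qed

section \<open>The closed loop\<close>

locale noisy_lq_problem = lq_problem N M A As B C D + prob_space P
  for N M :: nat
    and A :: "real^'n^'n" and As :: "nat \<Rightarrow> real^'n^'n" and B :: "real^'m^'n"
    and C :: "real^'n^'p" and D :: "real^'m^'p" and P :: "'a measure" +
  fixes w :: "nat \<Rightarrow> 'a \<Rightarrow> real^'n" and \<sigma> :: "nat \<Rightarrow> nat \<Rightarrow> 'a \<Rightarrow> real"
  assumes w_measurable: "\<And>k. w k \<in> borel_measurable P"
    and \<sigma>_measurable: "\<And>k i. i \<in> {1..M} \<Longrightarrow> \<sigma> k i \<in> borel_measurable P"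
    and noises_independent: "noises_independent P M w \<sigma>"
    and w_square: "\<And>k. integrable P (\<lambda>\<omega>. (norm (w k \<omega>))\<^sup>2)"
    and \<sigma>_square: "\<And>k i. i \<in> {1..M} \<Longrightarrow> integrable P (\<lambda>\<omega>. (\<sigma> k i \<omega>)\<^sup>2)"
    and w_mean: "\<And>k. (\<integral>\<omega>. w k \<omega> \<partial>P) = 0"
    and \<sigma>_mean: "\<And>k i. i \<in> {1..M} \<Longrightarrow> (\<integral>\<omega>. \<sigma> k i \<omega> \<partial>P) = 0"
    and w_cov: "\<And>k. second_moment P (w k) = mat 1"
    and \<sigma>_var: "\<And>k i. i \<in> {1..M} \<Longrightarrow> (\<integral>\<omega>. (\<sigma> k i \<omega>)\<^sup>2 \<partial>P) = 1"
begin

lemma square_integrable_w: "square_integrable P (w k)"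
  by (simp add: square_integrable_def w_measurable w_square)

lemma square_integrable_\<sigma>: "i \<in> {1..M} \<Longrightarrow> square_integrable P (\<sigma> k i)"
  using \<sigma>_square[of i k] by (simp add: square_integrable_def \<sigma>_measurable)

lemma square_integrable_const: "square_integrable P (\<lambda>_. c)"
  by (simp add: square_integrable_def)

lemma integrable_of_square_integrable: "square_integrable P f \<Longrightarrow> integrable P (f :: 'a \<Rightarrow> real)"
  using square_integrable_mult[OF _ square_integrable_const[of 1], of f] by simp

section \<open>Sigma-algebras generated by blocks of noises\<close>

definition noise_events :: "nat + nat \<times> nat \<Rightarrow> 'a set set" where
  "noise_events s = (case s of
      Inl k \<Rightarrow> {w k -` S \<inter> space P | S. S \<in> sets borel}
    | Inr (k, i) \<Rightarrow> {\<sigma> k i -` S \<inter> space P | S. S \<in> sets borel})"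

definition noise_sigma :: "(nat + nat \<times> nat) set \<Rightarrow> 'a measure" where
  "noise_sigma I = sigma (space P) (\<Union>s\<in>I. noise_events s)"

abbreviation noise_indices :: "(nat + nat \<times> nat) set" where
  "noise_indices \<equiv> UNIV <+> (UNIV \<times> {1..M})"

lemma noise_events_Pow: "(\<Union>s\<in>I. noise_events s) \<subseteq> Pow (space P)"
  by (auto simp: noise_events_def split: sum.splits)

text \<open>Preimages commute with intersections. This stability is what allows independence to pass
  to the sigma-algebras generated by unions of these families.\<close>

lemma noise_events_Int_stable: "Int_stable (noise_events s)"
proof (rule Int_stableI)
  fix a b
  assume "a \<in> noise_events s" "b \<in> noise_events s"
  then show "a \<inter> b \<in> noise_events s"
    unfolding noise_events_def
    by (cases s) (auto simp: Int_ac split: prod.splits; metis vimage_Int sets.Int Int_assoc Int_commute Int_left_absorb)+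
qed

lemma noise_events_subset: "s \<in> noise_indices \<Longrightarrow> noise_events s \<subseteq> sets P"
  using w_measurable \<sigma>_measurable
  by (auto simp: noise_events_def intro: measurable_sets)

lemma space_noise_sigma: "space (noise_sigma I) = space P"
  unfolding noise_sigma_def using noise_events_Pow by (rule space_measure_of)

lemma sets_noise_sigma: "sets (noise_sigma I) = sigma_sets (space P) (\<Union>s\<in>I. noise_events s)"
  unfolding noise_sigma_def using noise_events_Pow by (rule sets_measure_of)

lemma measurable_noise_sigma:
  assumes "I \<subseteq> noise_indices" "f \<in> measurable (noise_sigma I) N'"
  shows "f \<in> measurable P N'"
proof -
  have "sets (noise_sigma I) \<subseteq> sets P"
    unfolding sets_noise_sigma using assms(1) noise_events_subset
    by (intro sets.sigma_sets_subset) blast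
  then show ?thesis
    using assms(2) measurable_mono[of N' N' "noise_sigma I" P] by (auto simp: space_noise_sigma)
qed

lemma measurable_noise_sigma_mono:
  assumes "I \<subseteq> J" "f \<in> measurable (noise_sigma I) N'"
  shows "f \<in> measurable (noise_sigma J) N'"
proof -
  have "sets (noise_sigma I) \<subseteq> sets (noise_sigma J)"
    unfolding sets_noise_sigma using assms(1) by (intro sigma_sets_mono') blast
  then show ?thesis
    using assms(2) measurable_mono[of N' N' "noise_sigma I" "noise_sigma J"]
    by (auto simp: space_noise_sigma)
qed

lemma w_measurable_noise_sigma:
  assumes "Inl k \<in> I"
  shows "w k \<in> borel_measurable (noise_sigma I)"
proof (rule measurableI)
  fix S :: "(real^'n) set"
  assume "S \<in> sets borel"
  then have "w k -` S \<inter> space P \<in> noise_events (Inl k)"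
    by (auto simp: noise_events_def)
  then show "w k -` S \<inter> space (noise_sigma I) \<in> sets (noise_sigma I)"
    using assms unfolding space_noise_sigma sets_noise_sigma by (blast intro: sigma_sets.Basic)
qed simp

lemma \<sigma>_measurable_noise_sigma:
  assumes "Inr (k, i) \<in> I"
  shows "\<sigma> k i \<in> borel_measurable (noise_sigma I)"
proof (rule measurableI)
  fix S :: "real set"
  assume "S \<in> sets borel"
  then have "\<sigma> k i -` S \<inter> space P \<in> noise_events (Inr (k, i))"
    by (auto simp: noise_events_def)
  then show "\<sigma> k i -` S \<inter> space (noise_sigma I) \<in> sets (noise_sigma I)"
    using assms unfolding space_noise_sigma sets_noise_sigma by (blast intro: sigma_sets.Basic)
qed simp

text \<open>Disjoint blocks of an independent family generate independent sigma-algebras, and the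
  events of f and g lie in those of their blocks.\<close>

lemma indep_var_noise_sigma:
  fixes f g :: "'a \<Rightarrow> real"
  assumes "I \<subseteq> noise_indices" "J \<subseteq> noise_indices" "I \<inter> J = {}"
    and f: "f \<in> borel_measurable (noise_sigma I)" and g: "g \<in> borel_measurable (noise_sigma J)"
  shows "indep_var borel f borel g"
  unfolding indep_var_eq
proof (intro conjI)
  show "random_variable borel f" "random_variable borel g"
    using assms measurable_noise_sigma by blast+
  have "indep_sets noise_events noise_indices"
    using noises_independent unfolding noises_independent_def noise_events_def by simp
  \<comment> \<open>The two blocks are indexed by the booleans to match the definition of
    \<open>indep_set\<close>.\<close>
  then have "indep_sets noise_events (\<Union>b\<in>UNIV. case_bool I J b)"
    by (rule indep_sets_mono_index[rotated]) (use assms in \<open>auto split: bool.splits\<close>)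
  then have "indep_sets (\<lambda>b. sigma_sets (space P) (\<Union>s\<in>case_bool I J b. noise_events s)) UNIV"
    by (rule indep_sets_collect_sigma)
       (use assms(3) in \<open>auto simp: noise_events_Int_stable disjoint_family_on_def split: bool.splits\<close>)
  then show "indep_set (sigma_sets (space P) {f -` S \<inter> space P |S. S \<in> sets borel})
      (sigma_sets (space P) {g -` S \<inter> space P |S. S \<in> sets borel})"
    unfolding indep_set_def
  proof (rule indep_sets_mono_sets)
    have "sigma_sets (space P) {f -` S \<inter> space P |S. S \<in> sets borel}
        \<subseteq> sigma_sets (space P) (\<Union>s\<in>I. noise_events s)"
      using measurable_sets[OF f] by (intro sigma_sets_mono) (auto simp: space_noise_sigma sets_noise_sigma)
    moreover have "sigma_sets (space P) {g -` S \<inter> space P |S. S \<in> sets borel}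
        \<subseteq> sigma_sets (space P) (\<Union>s\<in>J. noise_events s)"
      using measurable_sets[OF g] by (intro sigma_sets_mono) (auto simp: space_noise_sigma sets_noise_sigma)
    ultimately show "(case b of True \<Rightarrow> sigma_sets (space P) {f -` S \<inter> space P |S. S \<in> sets borel}
        | False \<Rightarrow> sigma_sets (space P) {g -` S \<inter> space P |S. S \<in> sets borel})
        \<subseteq> sigma_sets (space P) (\<Union>s\<in>case_bool I J b. noise_events s)" for b
      by (cases b) auto
  qed
qed

text \<open>Only noises strictly before time k enter, since the state and input at time k are formed
  before the noises of time k act. Those noises are therefore independent of
  \<open>history k\<close>.\<close>

definition history :: "nat \<Rightarrow> 'a measure" where
  "history k = noise_sigma ({..<k} <+> ({..<k} \<times> {1..M}))"

lemma space_history: "space (history k) = space P"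
  by (simp add: history_def space_noise_sigma)

lemma measurable_history: "f \<in> measurable (history k) N' \<Longrightarrow> f \<in> measurable P N'"
  unfolding history_def by (rule measurable_noise_sigma[rotated]) auto

lemma measurable_history_mono:
  "j \<le> k \<Longrightarrow> f \<in> measurable (history j) N' \<Longrightarrow> f \<in> measurable (history k) N'"
  unfolding history_def by (rule measurable_noise_sigma_mono[rotated]) auto

lemma w_measurable_history: "j < k \<Longrightarrow> w j \<in> borel_measurable (history k)"
  unfolding history_def by (rule w_measurable_noise_sigma) auto

lemma \<sigma>_measurable_history:
  "j < k \<Longrightarrow> i \<in> {1..M} \<Longrightarrow> \<sigma> j i \<in> borel_measurable (history k)"
  unfolding history_def by (rule \<sigma>_measurable_noise_sigma) auto

lemma vec_nth_measurable: "f \<in> borel_measurable Q \<Longrightarrow> (\<lambda>\<omega>. (f \<omega> :: real^'k) $ i) \<in> borel_measurable Q"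
  by (rule borel_measurable_continuous_on[OF linear_continuous_on[OF bounded_linear_vec_nth]])

lemma matrix_vector_mult_measurable:
  "f \<in> borel_measurable Q \<Longrightarrow> (\<lambda>\<omega>. (X :: real^'k^'l) *v f \<omega>) \<in> borel_measurable Q"
  by (rule borel_measurable_continuous_on[OF linear_continuous_on[OF matrix_vector_mul_bounded_linear]])

section \<open>Moments of the noises at one time and the resulting one-step update\<close>

lemma expectation_w_nth: "expectation (\<lambda>\<omega>. w k \<omega> $ j) = 0"
proof -
  have "integrable P (\<lambda>\<omega>. norm (w k \<omega>))"
    by (rule square_integrable_imp_integrable[OF measurable_compose[OF w_measurable borel_measurable_norm] w_square])
  then have "integrable P (w k)"
    using w_measurable by (rule integrable_norm_cancel)
  then have "expectation (\<lambda>\<omega>. w k \<omega> $ j) = (\<integral>\<omega>. w k \<omega> \<partial>P) $ j"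
    by (rule integral_bounded_linear[OF bounded_linear_vec_nth])
  then show ?thesis by (simp add: w_mean)
qed

lemma expectation_w_mult: "expectation (\<lambda>\<omega>. w k \<omega> $ r * w k \<omega> $ c) = (if r = c then 1 else 0)"
  using w_cov[of k] by (simp add: second_moment_def mat_def vec_eq_iff)

lemma expectation_\<sigma>_mult:
  assumes "i \<in> {1..M}" "i' \<in> {1..M}"
  shows "expectation (\<lambda>\<omega>. \<sigma> k i \<omega> * \<sigma> k i' \<omega>) = (if i = i' then 1 else 0)"
proof (cases "i = i'")
  case True
  then show ?thesis
    using \<sigma>_var[OF assms(1), of k] by (simp add: power2_eq_square)
next
  case False
  have "indep_var borel (\<sigma> k i) borel (\<sigma> k i')"
    by (rule indep_var_noise_sigma[of "{Inr (k, i)}" "{Inr (k, i')}"])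
       (use assms False in \<open>auto intro: \<sigma>_measurable_noise_sigma\<close>)
  then have "expectation (\<lambda>\<omega>. \<sigma> k i \<omega> * \<sigma> k i' \<omega>) = expectation (\<sigma> k i) * expectation (\<sigma> k i')"
    using assms by (intro indep_var_lebesgue_integral integrable_of_square_integrable square_integrable_\<sigma>)
  then show ?thesis
    using False by (simp add: \<sigma>_mean[OF assms(1)])
qed

lemma expectation_\<sigma>_w:
  assumes "i \<in> {1..M}"
  shows "expectation (\<lambda>\<omega>. \<sigma> k i \<omega> * w k \<omega> $ j) = 0"
proof -
  have "indep_var borel (\<sigma> k i) borel (\<lambda>\<omega>. w k \<omega> $ j)"
    by (rule indep_var_noise_sigma[of "{Inr (k, i)}" "{Inl k}"])
       (use assms in \<open>auto intro: \<sigma>_measurable_noise_sigma w_measurable_noise_sigma vec_nth_measurable\<close>)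
  then have "expectation (\<lambda>\<omega>. \<sigma> k i \<omega> * w k \<omega> $ j) = expectation (\<sigma> k i) * expectation (\<lambda>\<omega>. w k \<omega> $ j)"
    using assms by (intro indep_var_lebesgue_integral integrable_of_square_integrable
        square_integrable_\<sigma> square_integrable_vec_nth square_integrable_w)
  then show ?thesis
    by (simp add: expectation_w_nth)
qed

text \<open>The next state is a combination of past-measurable vectors with coefficients taken from the
  system \<open>1, \<sigma> k i, w k $ j\<close>, which is orthonormal and independent of the past.\<close>

lemma
  fixes x y :: "'a \<Rightarrow> real^'n"
  assumes x: "x \<in> borel_measurable (history k)" "square_integrable P x"
    and y: "y \<in> borel_measurable (history k)" "square_integrable P y"
  defines "x' \<equiv> \<lambda>\<omega>. y \<omega> + (\<Sum>i=1..M. \<sigma> k i \<omega> *\<^sub>R (As i *v x \<omega>)) + w k \<omega>"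
  shows measurable_next_state: "x' \<in> borel_measurable (history (Suc k))"
    and square_integrable_next_state: "square_integrable P x'"
    and second_moment_next_state: "second_moment P x'
      = second_moment P y + (\<Sum>i=1..M. second_moment P (\<lambda>\<omega>. As i *v x \<omega>)) + mat 1"
proof -
  have "x \<in> borel_measurable (history (Suc k))" "y \<in> borel_measurable (history (Suc k))"
    using x(1) y(1) by (auto intro: measurable_history_mono[of k "Suc k"])
  then show "x' \<in> borel_measurable (history (Suc k))"
    unfolding x'_def
    by (intro borel_measurable_add borel_measurable_sum borel_measurable_scaleR
        matrix_vector_mult_measurable w_measurable_history \<sigma>_measurable_history) auto

  \<comment> \<open>\<open>Inl 0\<close> carries the coefficient 1 of y, \<open>Inl i\<close> with i
    in \<open>{1..M}\<close> the coefficient \<open>\<sigma> k i\<close> of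
    \<open>As i *v x\<close>, and \<open>Inr j\<close> the coefficient \<open>w k $ j\<close> of the
    j-th unit vector.\<close>
  define T where "T = ({..M} <+> UNIV :: (nat + 'n) set)"
  define s where "s t = (case t of
      Inl i \<Rightarrow> if i = 0 then (\<lambda>_. 1) else \<sigma> k i
    | Inr j \<Rightarrow> (\<lambda>\<omega>. w k \<omega> $ j))" for t :: "nat + 'n"
  define f where "f t = (case t of
      Inl i \<Rightarrow> if i = 0 then y else (\<lambda>\<omega>. As i *v x \<omega>)
    | Inr j \<Rightarrow> (\<lambda>_. axis j 1))" for t :: "nat + 'n"
  have "finite T"
    by (simp add: T_def)
  have sum_T: "(\<Sum>t\<in>T. g t) = g (Inl 0) + (\<Sum>i=1..M. g (Inl i)) + (\<Sum>j\<in>UNIV. g (Inr j))"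
    for g :: "nat + 'n \<Rightarrow> 'b::comm_monoid_add"
  proof -
    have "{..M} = insert 0 {1..M}" by auto
    then show ?thesis
      unfolding T_def by (simp add: sum.Plus)
  qed
  have x'_eq: "x' = (\<lambda>\<omega>. \<Sum>t\<in>T. s t \<omega> *\<^sub>R f t \<omega>)"
  proof
    fix \<omega>
    have "(\<Sum>j\<in>UNIV. w k \<omega> $ j *\<^sub>R axis j 1) = w k \<omega>"
      by (simp add: vec_eq_iff axis_def if_distrib cong: if_cong)
    then show "x' \<omega> = (\<Sum>t\<in>T. s t \<omega> *\<^sub>R f t \<omega>)"
      unfolding x'_def sum_T by (simp add: s_def f_def)
  qed
  have s_measurable: "s t \<in> borel_measurable (noise_sigma ({k} <+> ({k} \<times> {1..M})))"
    if "t \<in> T" for t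
    using that
    by (auto simp: s_def T_def intro!: w_measurable_noise_sigma \<sigma>_measurable_noise_sigma
        vec_nth_measurable)
  have f_measurable: "f t \<in> borel_measurable (history k)" for t
    using x(1) y(1) by (auto simp: f_def intro: matrix_vector_mult_measurable split: sum.split)
  have f: "square_integrable P (f t)" for t
    using x(2) y(2)
    by (auto simp: f_def intro: square_integrable_matrix_mult square_integrable_const split: sum.split)
  have s: "square_integrable P (s t)" if "t \<in> T" for t
    using that
    by (auto simp: s_def T_def intro!: square_integrable_const square_integrable_\<sigma>
        square_integrable_vec_nth square_integrable_w)
  \<comment> \<open>The vectors use noise times below k and the coefficients only time k, so the two
    blocks of indices are disjoint.\<close>
  have indep: "indep_var borel (\<lambda>\<omega>. f t \<omega> $ r * f t' \<omega> $ c) borel (\<lambda>\<omega>. s t \<omega> * s t' \<omega>)"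
    if "t \<in> T" "t' \<in> T" for t t' r c
  proof (rule indep_var_noise_sigma)
    show "(\<lambda>\<omega>. f t \<omega> $ r * f t' \<omega> $ c)
        \<in> borel_measurable (noise_sigma ({..<k} <+> ({..<k} \<times> {1..M})))"
      unfolding history_def[symmetric]
      by (intro borel_measurable_times vec_nth_measurable f_measurable)
    show "(\<lambda>\<omega>. s t \<omega> * s t' \<omega>) \<in> borel_measurable (noise_sigma ({k} <+> ({k} \<times> {1..M})))"
      using that by (intro borel_measurable_times s_measurable)
  qed auto
  have orthonormal: "expectation (\<lambda>\<omega>. s t \<omega> * s t' \<omega>) = (if t = t' then 1 else 0)"
    if "t \<in> T" "t' \<in> T" for t t'
    using that expectation_\<sigma>_w[of _ k]
    by (auto simp: s_def T_def \<sigma>_mean expectation_w_nth expectation_w_mult expectation_\<sigma>_mult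
        prob_space mult.commute[of "w k _ $ _" "\<sigma> k _ _"] split: if_splits)
  show "square_integrable P x'"
    unfolding x'_eq by (rule square_integrable_orthonormal_combination[OF f s indep orthonormal \<open>finite T\<close>])
  \<comment> \<open>The outer products of the unit vectors sum to the identity: the contribution of
    \<open>w k\<close>.\<close>
  have "axis j 1 $ r * axis j 1 $ c = (if j = r then if r = c then 1 else 0 else (0 :: real))"
    for j r c :: 'n
    by (auto simp: axis_def)
  then have "(\<Sum>j\<in>UNIV. second_moment P (\<lambda>_. axis j 1)) = (mat 1 :: real^'n^'n)"
    by (simp add: vec_eq_iff second_moment_def mat_def prob_space)
  moreover have "second_moment P x' = (\<Sum>t\<in>T. second_moment P (f t))"
    unfolding x'_eq by (rule second_moment_orthonormal_combination[OF f s indep orthonormal \<open>finite T\<close>])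
  ultimately show "second_moment P x'
      = second_moment P y + (\<Sum>i=1..M. second_moment P (\<lambda>\<omega>. As i *v x \<omega>)) + mat 1"
    unfolding sum_T by (simp add: f_def)
qed

text \<open>With v the stacked vector, the drift is \<open>AB *v v\<close> and the noise directions
  are \<open>(As i ** F) *v v\<close>; the second moments of these linear images are the congruences
  in \<open>next_moment\<close>.\<close>

lemma
  fixes x :: "'a \<Rightarrow> real^'n" and u :: "'a \<Rightarrow> real^'m"
  assumes x: "x \<in> borel_measurable (history k)" "square_integrable P x"
    and u: "u \<in> borel_measurable (history k)" "square_integrable P u"
    and x': "\<And>\<omega>. \<omega> \<in> space P \<Longrightarrow>
      x' \<omega> = (A + (\<Sum>i=1..M. \<sigma> k i \<omega> *\<^sub>R As i)) *v x \<omega> + B *v u \<omega> + w k \<omega>"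
  shows measurable_step: "x' \<in> borel_measurable (history (Suc k))"
    and square_integrable_step: "square_integrable P x'"
    and second_moment_step:
      "second_moment P x' = next_moment (second_moment P (\<lambda>\<omega>. joint_vec (x \<omega>) (u \<omega>)))"
proof -
  let ?v = "\<lambda>\<omega>. joint_vec (x \<omega>) (u \<omega>)"
  define y where "y \<omega> = AB *v ?v \<omega>" for \<omega>
  define n where "n \<omega> = y \<omega> + (\<Sum>i=1..M. \<sigma> k i \<omega> *\<^sub>R (As i *v x \<omega>)) + w k \<omega>" for \<omega>
  have v: "square_integrable P ?v"
    using x(2) u(2) by (rule square_integrable_joint_vec)
  have y: "y \<in> borel_measurable (history k)" "square_integrable P y"
    using x u unfolding y_def[abs_def]
    by (simp_all only: hblock_joint_vec borel_measurable_add matrix_vector_mult_measurable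
        square_integrable_add square_integrable_matrix_mult)
  have "(\<Sum>i\<in>I. c i *\<^sub>R As i) *v a = (\<Sum>i\<in>I. c i *\<^sub>R (As i *v a))" for c I a
    by (induction I rule: infinite_finite_induct)
       (auto simp: matrix_vector_mult_add_rdistrib scaleR_matrix_vector_assoc)
  then have x'_eq: "x' \<omega> = n \<omega>" if "\<omega> \<in> space P" for \<omega>
    using that by (simp add: x' n_def y_def hblock_joint_vec matrix_vector_mult_add_rdistrib)
  have "n \<in> borel_measurable (history (Suc k))"
    using measurable_next_state[OF x y] unfolding n_def[abs_def] .
  then show "x' \<in> borel_measurable (history (Suc k))"
    using x'_eq by (subst measurable_cong[of _ _ n]) (auto simp: space_history)
  have "square_integrable P n"
    using square_integrable_next_state[OF x y] unfolding n_def[abs_def] .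
  then show "square_integrable P x'"
    using square_integrable_cong[of P x' n] x'_eq by blast
  have AB_moment: "second_moment P y = AB ** second_moment P ?v ** transpose AB"
    unfolding y_def[abs_def] by (rule second_moment_matrix_mult[OF v])
  have As_moment: "second_moment P (\<lambda>\<omega>. As i *v x \<omega>)
      = As i ** F ** second_moment P ?v ** transpose F ** transpose (As i)" for i
  proof -
    have "(As i ** F) *v ?v \<omega> = As i *v x \<omega>" for \<omega>
      by (simp add: matrix_vector_mul_assoc[symmetric] hblock_joint_vec)
    then show ?thesis
      using second_moment_matrix_mult[OF v, of "As i ** F"]
      by (simp add: matrix_transpose_mul matrix_mul_assoc)
  qed
  have "second_moment P x' = second_moment P n"
    by (rule second_moment_cong[OF x'_eq])
  also have "\<dots> = second_moment P y + (\<Sum>i=1..M. second_moment P (\<lambda>\<omega>. As i *v x \<omega>)) + mat 1"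
    using second_moment_next_state[OF x y] unfolding n_def[abs_def] .
  also have "\<dots> = next_moment (second_moment P ?v)"
    by (simp only: next_moment_def AB_moment As_moment)
  finally show "second_moment P x' = next_moment (second_moment P ?v)" .
qed

section \<open>Moments along an admissible closed loop\<close>

text \<open>Forward induction in time: causality makes the input measurable with respect to the past
  noises, admissibility gives its second moment, and the dynamics pass both properties to the next
  state.\<close>

lemma admissible_regular:
  assumes "admissible_closed_loop P N M A As B C D w \<sigma> \<mu> x u z" and "k < N"
  shows "x k \<in> borel_measurable (history k)" "square_integrable P (x k)"
    "u k \<in> borel_measurable (history k)" "square_integrable P (u k)"
proof -
  note loop = assms(1)[unfolded admissible_closed_loop_def]
  have x0: "x 0 \<omega> = 0" if "\<omega> \<in> space P" for \<omega>
    using loop that by blast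
  have policy: "u k \<omega> = \<mu> k (\<lambda>j\<in>{..k}. x j \<omega>)" if "k < N" "\<omega> \<in> space P" for k \<omega>
    using loop that by blast
  have u_square: "integrable P (\<lambda>\<omega>. (norm (u k \<omega>))\<^sup>2)" if "k < N" for k
    using loop that by blast
  have u_reg: "u k \<in> borel_measurable (history k)" "square_integrable P (u k)"
    if "k < N" "\<forall>j\<le>k. x j \<in> borel_measurable (history j)" for k
  proof -
    have "(\<lambda>\<omega>. \<lambda>j\<in>{..k}. x j \<omega>) \<in> measurable (history k) (\<Pi>\<^sub>M j\<in>{..k}. borel)"
      using that(2) by (intro measurable_restrict) (auto intro: measurable_history_mono)
    moreover have "\<mu> k \<in> borel_measurable (\<Pi>\<^sub>M j\<in>{..k}. borel)"
      using loop that(1) by blast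
    ultimately have "(\<lambda>\<omega>. \<mu> k (\<lambda>j\<in>{..k}. x j \<omega>)) \<in> borel_measurable (history k)"
      by (rule measurable_compose)
    then show "u k \<in> borel_measurable (history k)"
      using policy[OF that(1)]
      by (subst measurable_cong[of _ _ "\<lambda>\<omega>. \<mu> k (\<lambda>j\<in>{..k}. x j \<omega>)"]) (simp_all add: space_history)
    then show "square_integrable P (u k)"
      using u_square[OF that(1)] by (auto simp: square_integrable_def intro: measurable_history)
  qed
  \<comment> \<open>The claim covers all times up to k because the policy at time k reads the whole
    past trajectory.\<close>
  have reg: "\<forall>j\<le>k. x j \<in> borel_measurable (history j) \<and> square_integrable P (x j)" if "k < N" for k
    using that
  proof (induction k)
    case 0
    have "x 0 \<in> borel_measurable (history 0)"
      using x0 by (subst measurable_cong[of _ _ "\<lambda>_. 0"]) (auto simp: space_history)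
    moreover have "square_integrable P (x 0) \<longleftrightarrow> square_integrable P (\<lambda>_. 0 :: real^'n)"
      by (rule square_integrable_cong) (rule x0)
    ultimately show ?case
      using square_integrable_const by auto
  next
    case (Suc k)
    then have k: "k < N" and IH: "\<forall>j\<le>k. x j \<in> borel_measurable (history j) \<and> square_integrable P (x j)"
      by auto
    have step: "x (Suc k) \<omega> = (A + (\<Sum>i=1..M. \<sigma> k i \<omega> *\<^sub>R As i)) *v x k \<omega> + B *v u k \<omega> + w k \<omega>"
      if "\<omega> \<in> space P" for \<omega>
      using loop k that by blast
    have "x k \<in> borel_measurable (history k)" "square_integrable P (x k)"
      "u k \<in> borel_measurable (history k)" "square_integrable P (u k)"
      using IH u_reg[OF k] by auto
    note this step
    from measurable_step[OF this] square_integrable_step[OF this] IH show ?case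
      by (auto simp: le_Suc_eq)
  qed
  show "x k \<in> borel_measurable (history k)" "square_integrable P (x k)"
    "u k \<in> borel_measurable (history k)" "square_integrable P (u k)"
    using reg[OF assms(2)] u_reg[OF assms(2)] by auto
qed

abbreviation joint_moment :: "('a \<Rightarrow> real^'n) \<Rightarrow> ('a \<Rightarrow> real^'m) \<Rightarrow> real^('n + 'm)^('n + 'm)" where
  "joint_moment x u \<equiv> second_moment P (\<lambda>\<omega>. joint_vec (x \<omega>) (u \<omega>))"

text \<open>These facts translate trajectories into matrices: they give the constraints and the
  objective of the program at the moments of the stacked vectors.\<close>

lemma
  assumes "admissible_closed_loop P N M A As B C D w \<sigma> \<mu> x u z" and "k < N"
  shows admissible_joint_moment: "psd (joint_moment (x k) (u k))"
    and admissible_state_moment: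
      "F ** joint_moment (x k) (u k) ** transpose F = second_moment P (x k)"
    and admissible_next_moment: "second_moment P (x (Suc k)) = next_moment (joint_moment (x k) (u k))"
    and admissible_cost: "(\<integral>\<omega>. z k \<omega> \<bullet> z k \<omega> \<partial>P)
      = trace (L ** joint_moment (x k) (u k) ** transpose L)"
proof -
  note loop = assms(1)[unfolded admissible_closed_loop_def]
  note reg = admissible_regular[OF assms]
  let ?v = "\<lambda>\<omega>. joint_vec (x k \<omega>) (u k \<omega>)"
  have v: "square_integrable P ?v"
    using reg by (intro square_integrable_joint_vec)
  show "psd (joint_moment (x k) (u k))"
    by (rule psd_second_moment[OF v])
  show "F ** joint_moment (x k) (u k) ** transpose F = second_moment P (x k)"
    using second_moment_matrix_mult[OF v, of F] by (simp add: hblock_joint_vec)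
  have "x (Suc k) \<omega> = (A + (\<Sum>i=1..M. \<sigma> k i \<omega> *\<^sub>R As i)) *v x k \<omega> + B *v u k \<omega> + w k \<omega>"
    if "\<omega> \<in> space P" for \<omega>
    using loop assms(2) that by blast
  from second_moment_step[OF reg this]
  show "second_moment P (x (Suc k)) = next_moment (joint_moment (x k) (u k))" .
  have "z k \<omega> = L *v ?v \<omega>" if "\<omega> \<in> space P" for \<omega>
    unfolding hblock_joint_vec using loop assms(2) that by blast
  then have "(\<integral>\<omega>. z k \<omega> \<bullet> z k \<omega> \<partial>P) = (\<integral>\<omega>. (L *v ?v \<omega>) \<bullet> (L *v ?v \<omega>) \<partial>P)"
    by (intro Bochner_Integration.integral_cong) auto
  also have "\<dots> = trace (second_moment P (\<lambda>\<omega>. L *v ?v \<omega>))"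
    using v by (intro trace_second_moment[symmetric] square_integrable_matrix_mult)
  finally show "(\<integral>\<omega>. z k \<omega> \<bullet> z k \<omega> \<partial>P) = trace (L ** joint_moment (x k) (u k) ** transpose L)"
    unfolding second_moment_matrix_mult[OF v] .
qed

lemma admissible_imp_sdp_feasible:
  assumes "admissible_closed_loop P N M A As B C D w \<sigma> \<mu> x u z"
  shows "sdp_feasible N M A As B (\<lambda>k. joint_moment (x k) (u k))"
  unfolding sdp_feasible_next_moment
  using assms
  by (auto simp: admissible_joint_moment admissible_state_moment
      intro!: admissible_next_moment dest: Suc_lessD)

section \<open>The closed loop under the optimal linear feedback\<close>

primrec opt_state :: "nat \<Rightarrow> 'a \<Rightarrow> real^'n" where
  "opt_state 0 = (\<lambda>_. 0)"
| "opt_state (Suc k) = (\<lambda>\<omega>. (A + (\<Sum>i=1..M. \<sigma> k i \<omega> *\<^sub>R As i)) *v opt_state k \<omega>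
     + B *v (opt_gain k *v opt_state k \<omega>) + w k \<omega>)"

lemma opt_state_regular:
  "opt_state k \<in> borel_measurable (history k) \<and> square_integrable P (opt_state k)"
proof (induction k)
  case 0
  then show ?case by (simp add: square_integrable_const)
next
  case (Suc k)
  then have "opt_state k \<in> borel_measurable (history k)" "square_integrable P (opt_state k)"
    "(\<lambda>\<omega>. opt_gain k *v opt_state k \<omega>) \<in> borel_measurable (history k)"
    "square_integrable P (\<lambda>\<omega>. opt_gain k *v opt_state k \<omega>)"
    by (auto intro: matrix_vector_mult_measurable square_integrable_matrix_mult)
  from measurable_step[OF this] square_integrable_step[OF this] show ?case
    by simp
qed

lemma opt_admissible:
  "admissible_closed_loop P N M A As B C D w \<sigma>
     (\<lambda>k h. opt_gain k *v h k) opt_state (\<lambda>k \<omega>. opt_gain k *v opt_state k \<omega>)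
     (\<lambda>k \<omega>. C *v opt_state k \<omega> + D *v (opt_gain k *v opt_state k \<omega>))"
proof -
  \<comment> \<open>The policy reads only the latest state of the history, a measurable coordinate
    projection followed by a linear map.\<close>
  have "(\<lambda>h. opt_gain k *v h k) \<in> borel_measurable (\<Pi>\<^sub>M j\<in>{..k}. borel)" for k
    by (intro matrix_vector_mult_measurable measurable_component_singleton) simp
  moreover have "integrable P (\<lambda>\<omega>. (norm (opt_gain k *v opt_state k \<omega>))\<^sup>2)" for k
    using square_integrable_matrix_mult[of P "opt_state k" "opt_gain k"] opt_state_regular[of k]
    by (simp add: square_integrable_def)
  ultimately show ?thesis
    by (simp add: admissible_closed_loop_def)
qed

text \<open>The state moments of this loop start at zero and follow \<open>next_moment\<close> along
  the minimizing gains, which is the situation of \<open>opt_value_attained\<close>.\<close>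

lemma opt_cost:
  "(\<Sum>k<N. \<integral>\<omega>. (C *v opt_state k \<omega> + D *v (opt_gain k *v opt_state k \<omega>))
      \<bullet> (C *v opt_state k \<omega> + D *v (opt_gain k *v opt_state k \<omega>)) \<partial>P) = opt_value"
proof -
  let ?V = "\<lambda>k. joint_moment (opt_state k) (\<lambda>\<omega>. opt_gain k *v opt_state k \<omega>)"
  have "(\<Sum>k<N. trace (L ** ?V k ** transpose L)) = opt_value"
  proof (rule opt_value_attained)
    show "second_moment P (opt_state 0) = 0"
      by (simp add: second_moment_def vec_eq_iff)
    show "?V k = graph_matrix (opt_gain k) ** second_moment P (opt_state k)
        ** transpose (graph_matrix (opt_gain k))" for k
      using second_moment_matrix_mult[of P "opt_state k" "graph_matrix (opt_gain k)"]
        opt_state_regular[of k] by (simp add: graph_matrix_mult)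
    show "second_moment P (opt_state (Suc k)) = next_moment (?V k)" if "k < N" for k
      using admissible_next_moment[OF opt_admissible that] .
  qed
  moreover have "(\<Sum>k<N. \<integral>\<omega>. (C *v opt_state k \<omega> + D *v (opt_gain k *v opt_state k \<omega>))
      \<bullet> (C *v opt_state k \<omega> + D *v (opt_gain k *v opt_state k \<omega>)) \<partial>P)
      = (\<Sum>k<N. trace (L ** ?V k ** transpose L))"
    by (intro sum.cong refl admissible_cost[OF opt_admissible]) simp
  ultimately show ?thesis by simp
qed

section \<open>Comparison of the two infima\<close>

lemma control_value_le:
  assumes "admissible_closed_loop P N M A As B C D w \<sigma> \<mu> x u z"
  shows "control_value P N M A As B C D w \<sigma> \<le> ereal (1 / real N * (\<Sum>k<N. \<integral>\<omega>. z k \<omega> \<bullet> z k \<omega> \<partial>P))"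
  unfolding control_value_def by (rule Inf_lower) (use assms in blast)

lemma sdp_value_le:
  assumes "sdp_feasible N M A As B V"
  shows "sdp_value N M A As B C D \<le> ereal (1 / real N * (\<Sum>k<N. trace (L ** V k ** transpose L)))"
  unfolding sdp_value_def by (rule Inf_lower) (use assms in blast)

text \<open>The control value is at most \<open>opt_value / N\<close> by the optimal feedback, this
  is at most the program's value by the Riccati bound, and the program's value is at most the
  control value by passing to moments.\<close>

lemma control_value_eq_sdp_value:
  "control_value P N M A As B C D w \<sigma> = sdp_value N M A As B C D"
proof (rule antisym)
  have "control_value P N M A As B C D w \<sigma> \<le> ereal (1 / real N * opt_value)"
    using control_value_le[OF opt_admissible] unfolding opt_cost .
  also have "\<dots> \<le> sdp_value N M A As B C D"
    unfolding sdp_value_def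
  proof (rule Inf_greatest, clarify)
    fix V
    assume "sdp_feasible N M A As B V"
    then show "ereal (1 / real N * opt_value)
        \<le> ereal (1 / real N * (\<Sum>k<N. trace (L ** V k ** transpose L)))"
      unfolding ereal_less_eq by (intro mult_left_mono opt_value_le_sdp) auto
  qed
  finally show "control_value P N M A As B C D w \<sigma> \<le> sdp_value N M A As B C D" .
  show "sdp_value N M A As B C D \<le> control_value P N M A As B C D w \<sigma>"
    unfolding control_value_def
  proof (rule Inf_greatest, clarify)
    fix \<mu> x u z
    assume loop: "admissible_closed_loop P N M A As B C D w \<sigma> \<mu> x u z"
    have cost: "(\<Sum>k<N. \<integral>\<omega>. z k \<omega> \<bullet> z k \<omega> \<partial>P)
        = (\<Sum>k<N. trace (L ** joint_moment (x k) (u k) ** transpose L))"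
      by (intro sum.cong refl admissible_cost[OF loop]) simp
    show "sdp_value N M A As B C D \<le> ereal (1 / real N * (\<Sum>k<N. \<integral>\<omega>. z k \<omega> \<bullet> z k \<omega> \<partial>P))"
      unfolding cost by (rule sdp_value_le[OF admissible_imp_sdp_feasible[OF loop]])
  qed
qed

end

theorem theorem1:
  fixes P :: "'a measure"
    and N M :: nat
    and A :: "real^'n^'n" and As :: "nat \<Rightarrow> real^'n^'n" and B :: "real^'m^'n"
    and C :: "real^'n^'p" and D :: "real^'m^'p"
    and w :: "nat \<Rightarrow> 'a \<Rightarrow> real^'n" and \<sigma> :: "nat \<Rightarrow> nat \<Rightarrow> 'a \<Rightarrow> real"
  assumes "prob_space P"
    and "N \<ge> 1"
    and "pos_def (transpose (hblock C D) ** hblock C D)"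
    and "\<And>k. w k \<in> borel_measurable P"
    and "\<And>k i. i \<in> {1..M} \<Longrightarrow> \<sigma> k i \<in> borel_measurable P"
    and "noises_independent P M w \<sigma>"
    and "\<And>k. integrable P (\<lambda>\<omega>. (norm (w k \<omega>))\<^sup>2)"
    and "\<And>k i. i \<in> {1..M} \<Longrightarrow> integrable P (\<lambda>\<omega>. (\<sigma> k i \<omega>)\<^sup>2)"
    and "\<And>k. (\<integral>\<omega>. w k \<omega> \<partial>P) = 0"
    and "\<And>k i. i \<in> {1..M} \<Longrightarrow> (\<integral>\<omega>. \<sigma> k i \<omega> \<partial>P) = 0"
    and "\<And>k. (\<chi> r c. \<integral>\<omega>. w k \<omega> $ r * w k \<omega> $ c \<partial>P) = (mat 1 :: real^'n^'n)"
    and "\<And>k i. i \<in> {1..M} \<Longrightarrow> (\<integral>\<omega>. (\<sigma> k i \<omega>)\<^sup>2 \<partial>P) = 1"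
  shows "control_value P N M A As B C D w \<sigma> = sdp_value N M A As B C D"
proof -
  interpret prob_space P by fact
  \<comment> \<open>Unfolding \<open>second_moment\<close> identifies the covariance hypothesis on w
    with the locale assumption \<open>w_cov\<close>.\<close>
  interpret noisy_lq_problem N M A As B C D P w \<sigma>
    by unfold_locales (unfold second_moment_def, (rule assms; assumption)+)
  show ?thesis by (rule control_value_eq_sdp_value)
qed

end
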